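(* Let $C$ be a bounded convex subset of a Banach space $X$ and let $\mathcal U$ be a countably incomplete ultrafilter on an infinite set $I$. Then every point of $C_{\mathcal U}$ that is exposed in $C_{\mathcal U}$ by some functional in $(X^* )_{\mathcal U}$ is a strongly exposed point of $C_{\mathcal U}$ (i.e. it is strongly exposed by some functional in $(X_{\mathcal U})^*$).
   Context: Banach spaces are real. A free (i.e. non-principal) ultrafilter $\mathcal U$ on a set $I$ is countably incomplete if there is a sequence $(I_n)_{n\in\mathbb N}\subset\mathcal U$ with $\bigcap_n I_n=\emptyset$. The ultrapower is $X_{\mathcal U}=\ell_\infty(I,X)/\{(x_i)_{i\in I}:\lim_{\mathcal U}\|x_i\|=0\}$; the class of $(x_i)_{i\in I}$ is written $(x_i)_{\mathcal U}$ and has norm $\lim_{\mathcal U}\|x_i\|$. For bounded $A\subset X$, $A_{\mathcal U}=\{(x_i)_{\mathcal U}: x_i\in A\ \forall i\in I\}$. $(X^* )_{\mathcal U}$ is regarded as a subspace of $(X_{\mathcal U})^*$ through $\langle (x_i^* )_{\mathcal U},(x_i)_{\mathcal U}\rangle=\lim_{\mathcal U}x_i^*(x_i)$. For a bounded convex set $D$ in a Banach space $Y$ and $y^*\in Y^*$: $y^*$ exposes $y\in D$ in $D$ if $y^*(y)>y^*(z)$ for all $z\in D\setminus\{y\}$; $y^*$ strongly exposes $y$ in $D$ if it exposes $y$ and, for every sequence $(y_n)$ in $D$ with $y^*(y_n)\to y^*(y)$, one has $y_n\to y$ in norm. *)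

theory Defs
  imports "HOL-Analysis.Analysis"
begin

text \<open>
  The ultrapower depends on the ultrafilter, which is a term, so it cannot be a HOL type.
  It is built as a real normed space with an explicit carrier.  The index set is
  the universe of a type \<open>'i\<close>, and an ultrafilter is a filter in the library's sense.
\<close>

definition ultrafilter :: "'i filter \<Rightarrow> bool" where
  "ultrafilter U \<longleftrightarrow>
     U \<noteq> bot \<and> (\<forall>P. eventually P U \<or> eventually (\<lambda>i. \<not> P i) U)"

definition free_ultrafilter :: "'i filter \<Rightarrow> bool" where
  "free_ultrafilter U \<longleftrightarrow> ultrafilter U \<and> (\<nexists>a. U = principal {a})"

definition countably_incomplete_ultrafilter :: "'i filter \<Rightarrow> bool" where
  "countably_incomplete_ultrafilter U \<longleftrightarrow> free_ultrafilter U \<and>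
     (\<exists>J :: nat \<Rightarrow> 'i set. (\<forall>n. eventually (\<lambda>i. i \<in> J n) U) \<and> (\<Inter>n. J n) = {})"


subsection \<open>Real normed spaces with a carrier, functionals, exposed points\<close>

record 'v nspace =
  carr :: "'v set"
  vadd :: "'v \<Rightarrow> 'v \<Rightarrow> 'v"
  vscale :: "real \<Rightarrow> 'v \<Rightarrow> 'v"
  vnorm :: "'v \<Rightarrow> real"

definition vdist :: "'v nspace \<Rightarrow> 'v \<Rightarrow> 'v \<Rightarrow> real" where
  "vdist Y u v = vnorm Y (vadd Y u (vscale Y (-1) v))"

text \<open>The bounded linear functionals; only their values on the carrier are relevant.\<close>

definition dual_space :: "'v nspace \<Rightarrow> ('v \<Rightarrow> real) set" where
  "dual_space Y = {f.
     (\<forall>u\<in>carr Y. \<forall>v\<in>carr Y. f (vadd Y u v) = f u + f v) \<and>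
     (\<forall>c. \<forall>u\<in>carr Y. f (vscale Y c u) = c * f u) \<and>
     (\<exists>K. \<forall>u\<in>carr Y. \<bar>f u\<bar> \<le> K * vnorm Y u)}"

definition exposes :: "('v \<Rightarrow> real) \<Rightarrow> 'v \<Rightarrow> 'v set \<Rightarrow> bool" where
  "exposes f y D \<longleftrightarrow> y \<in> D \<and> (\<forall>z \<in> D - {y}. f y > f z)"

definition strongly_exposes :: "'v nspace \<Rightarrow> ('v \<Rightarrow> real) \<Rightarrow> 'v \<Rightarrow> 'v set \<Rightarrow> bool" where
  "strongly_exposes Y f y D \<longleftrightarrow> exposes f y D \<and>
     (\<forall>s :: nat \<Rightarrow> 'v. (\<forall>n. s n \<in> D) \<and> (\<lambda>n. f (s n)) \<longlonglongrightarrow> f y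
        \<longrightarrow> (\<lambda>n. vdist Y (s n) y) \<longlonglongrightarrow> 0)"

definition strongly_exposed_point :: "'v nspace \<Rightarrow> 'v \<Rightarrow> 'v set \<Rightarrow> bool" where
  "strongly_exposed_point Y y D \<longleftrightarrow> (\<exists>f \<in> dual_space Y. strongly_exposes Y f y D)"


subsection \<open>Ultrapowers\<close>

definition ell_infty :: "('i \<Rightarrow> 'a::real_normed_vector) set" where
  "ell_infty = {x. bounded (range x)}"

definition ultra_rel ::
    "'i filter \<Rightarrow> (('i \<Rightarrow> 'a::real_normed_vector) \<times> ('i \<Rightarrow> 'a)) set" where
  "ultra_rel U = {(x, y). x \<in> ell_infty \<and> y \<in> ell_infty \<and>
     ((\<lambda>i. norm (x i - y i)) \<longlongrightarrow> 0) U}"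

definition ultra_class ::
    "'i filter \<Rightarrow> ('i \<Rightarrow> 'a::real_normed_vector) \<Rightarrow> ('i \<Rightarrow> 'a) set" where
  "ultra_class U x = ultra_rel U `` {x}"

text \<open>
  The operations and the norm are those induced on classes by representatives.  They are
  independent of the representatives for an ultrafilter; see the lemmas
  \<open>vadd_ultra_class\<close>, \<open>vscale_ultra_class\<close> and \<open>vnorm_ultra_class\<close> below.
\<close>

definition ultrapower :: "'i filter \<Rightarrow> ('i \<Rightarrow> 'a::real_normed_vector) set nspace" where
  "ultrapower U = \<lparr>
     carr = ell_infty // ultra_rel U,
     vadd = (\<lambda>A B. \<Union>x\<in>A. \<Union>y\<in>B. ultra_class U (\<lambda>i. x i + y i)),
     vscale = (\<lambda>c A. \<Union>x\<in>A. ultra_class U (\<lambda>i. c *\<^sub>R x i)),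
     vnorm = (\<lambda>A. the_elem ((\<lambda>x. Lim U (\<lambda>i. norm (x i))) ` A)) \<rparr>"

definition ultra_set ::
    "'i filter \<Rightarrow> 'a::real_normed_vector set \<Rightarrow> ('i \<Rightarrow> 'a) set set" where
  "ultra_set U A = {ultra_class U x | x. \<forall>i. x i \<in> A}"

text \<open>
  The functional on the ultrapower of \<open>'a\<close> given by an element of the ultrapower of the dual
  \<open>'a \<Rightarrow>\<^sub>L real\<close>; see \<open>ultra_pairing_ultra_class\<close> and \<open>ultra_pairing_in_dual\<close>.
\<close>

definition ultra_pairing ::
    "'i filter \<Rightarrow> ('i \<Rightarrow> 'a::real_normed_vector \<Rightarrow>\<^sub>L real) set \<Rightarrow> ('i \<Rightarrow> 'a) set \<Rightarrow> real" where
  "ultra_pairing U F A =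
     the_elem ((\<lambda>(f, x). Lim U (\<lambda>i. blinfun_apply (f i) (x i))) ` (F \<times> A))"


subsection \<open>Independence of representatives\<close>

lemma ultrafilter_tendsto_Lim:
  fixes g :: "'i \<Rightarrow> real"
  assumes "ultrafilter U" "bounded (range g)"
  shows "(g \<longlongrightarrow> Lim U g) U"
proof -
  have nb: "U \<noteq> bot" using assms(1) by (simp add: ultrafilter_def)
  have "compact (closure (range g))" using assms(2) by simp
  moreover have "filtermap g U \<noteq> bot" using nb by (simp add: filtermap_bot_iff)
  moreover have "eventually (\<lambda>r. r \<in> closure (range g)) (filtermap g U)"
    by (simp add: eventually_filtermap closure_subset [THEN subsetD])
  ultimately obtain l where l: "inf (nhds l) (filtermap g U) \<noteq> bot"
    unfolding compact_filter by blast
  have "eventually (\<lambda>i. g i \<in> S) U" if S: "open S" "l \<in> S" for S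
  proof (rule ccontr)
    assume "\<not> eventually (\<lambda>i. g i \<in> S) U"
    then have "eventually (\<lambda>i. g i \<notin> S) U"
      using assms(1) by (auto simp: ultrafilter_def)
    then have "eventually (\<lambda>r. r \<notin> S) (filtermap g U)"
      by (simp add: eventually_filtermap)
    moreover have "eventually (\<lambda>r. r \<in> S) (nhds l)"
      using S eventually_nhds by blast
    ultimately have "eventually (\<lambda>r. False) (inf (nhds l) (filtermap g U))"
      unfolding eventually_inf by blast
    then show False using l by (simp add: eventually_False)
  qed
  then have "(g \<longlongrightarrow> l) U" by (auto simp: tendsto_def)
  then show ?thesis using tendsto_Lim [OF nb] by metis
qed

lemma ultra_rel_equiv:
  "equiv ell_infty (ultra_rel U :: (('i \<Rightarrow> 'a::real_normed_vector) \<times> ('i \<Rightarrow> 'a)) set)"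
    (is "equiv _ ?R")
proof (rule equivI)
  show "?R \<subseteq> ell_infty \<times> ell_infty" by (auto simp: ultra_rel_def)
  show "refl_on ell_infty ?R"
    by (auto simp: refl_on_def ultra_rel_def)
  show "sym ?R"
    by (auto simp: sym_def ultra_rel_def norm_minus_commute)
  show "trans ?R"
  proof (rule transI)
    fix x y z :: "'i \<Rightarrow> 'a"
    assume xy: "(x, y) \<in> ultra_rel U" and yz: "(y, z) \<in> ultra_rel U"
    then have "((\<lambda>i. (x i - y i) + (y i - z i)) \<longlongrightarrow> 0 + 0) U"
      by (intro tendsto_add) (auto simp: ultra_rel_def tendsto_norm_zero_iff)
    then have "((\<lambda>i. norm (x i - z i)) \<longlongrightarrow> 0) U"
      by (simp add: tendsto_norm_zero_iff)
    then show "(x, z) \<in> ultra_rel U"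
      using xy yz by (auto simp: ultra_rel_def)
  qed
qed

lemma ultra_class_self: "x \<in> ell_infty \<Longrightarrow> x \<in> ultra_class U x"
  unfolding ultra_class_def by (rule equiv_class_self [OF ultra_rel_equiv])

lemma ultra_class_mem_iff:
  "y \<in> ultra_class U x \<longleftrightarrow>
     x \<in> ell_infty \<and> y \<in> ell_infty \<and> ((\<lambda>i. x i - y i) \<longlongrightarrow> 0) U"
  by (simp add: ultra_class_def ultra_rel_def tendsto_norm_zero_iff)

lemma ultra_class_eq_iff:
  assumes "x \<in> ell_infty" "y \<in> ell_infty"
  shows "ultra_class U x = ultra_class U y \<longleftrightarrow> ((\<lambda>i. norm (x i - y i)) \<longlongrightarrow> 0) U"
  using eq_equiv_class_iff [OF ultra_rel_equiv assms, of U] assms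
  by (simp add: ultra_class_def ultra_rel_def)

lemma ultra_class_eqI:
  assumes "x \<in> ell_infty" "y \<in> ell_infty" "((\<lambda>i. x i - y i) \<longlongrightarrow> 0) U"
  shows "ultra_class U y = ultra_class U x"
  using assms ultra_class_eq_iff [of x y U] by (simp add: tendsto_norm_zero_iff)

lemma carr_ultrapower: "carr (ultrapower U) = ultra_class U ` ell_infty"
  by (auto simp: ultrapower_def quotient_def ultra_class_def)

lemma ell_infty_add:
  "x \<in> ell_infty \<Longrightarrow> y \<in> ell_infty \<Longrightarrow> (\<lambda>i. x i + y i) \<in> ell_infty"
  unfolding ell_infty_def mem_Collect_eq by (rule bounded_plus_comp)

lemma ell_infty_scale: "x \<in> ell_infty \<Longrightarrow> (\<lambda>i. c *\<^sub>R x i) \<in> ell_infty"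
  unfolding ell_infty_def mem_Collect_eq by (rule bounded_scaleR_comp)

lemma vadd_ultra_class:
  assumes "x \<in> ell_infty" "y \<in> ell_infty"
  shows "vadd (ultrapower U) (ultra_class U x) (ultra_class U y) = ultra_class U (\<lambda>i. x i + y i)"
proof -
  have "ultra_class U (\<lambda>i. x' i + y' i) = ultra_class U (\<lambda>i. x i + y i)"
    if "x' \<in> ultra_class U x" "y' \<in> ultra_class U y" for x' y'
  proof (rule ultra_class_eqI)
    have "((\<lambda>i. (x i - x' i) + (y i - y' i)) \<longlongrightarrow> 0 + 0) U"
      by (intro tendsto_add) (use that in \<open>auto simp: ultra_class_mem_iff\<close>)
    then show "((\<lambda>i. (x i + y i) - (x' i + y' i)) \<longlongrightarrow> 0) U"
      by (simp add: algebra_simps)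
  qed (use that in \<open>auto simp: ultra_class_mem_iff ell_infty_add\<close>)
  then have "vadd (ultrapower U) (ultra_class U x) (ultra_class U y) =
      (\<Union>x'\<in>ultra_class U x. \<Union>y'\<in>ultra_class U y. ultra_class U (\<lambda>i. x i + y i))"
    by (simp add: ultrapower_def cong: SUP_cong_simp)
  moreover have "ultra_class U x \<noteq> {}" "ultra_class U y \<noteq> {}"
    using assms ultra_class_self by blast+
  ultimately show ?thesis by simp
qed

lemma vscale_ultra_class:
  assumes "x \<in> ell_infty"
  shows "vscale (ultrapower U) c (ultra_class U x) = ultra_class U (\<lambda>i. c *\<^sub>R x i)"
proof -
  have "ultra_class U (\<lambda>i. c *\<^sub>R x' i) = ultra_class U (\<lambda>i. c *\<^sub>R x i)"
    if "x' \<in> ultra_class U x" for x'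
  proof (rule ultra_class_eqI)
    have "((\<lambda>i. c *\<^sub>R (x i - x' i)) \<longlongrightarrow> c *\<^sub>R 0) U"
      by (intro tendsto_intros) (use that in \<open>auto simp: ultra_class_mem_iff\<close>)
    then show "((\<lambda>i. c *\<^sub>R x i - c *\<^sub>R x' i) \<longlongrightarrow> 0) U"
      by (simp add: algebra_simps)
  qed (use that in \<open>auto simp: ultra_class_mem_iff ell_infty_scale\<close>)
  then have "vscale (ultrapower U) c (ultra_class U x) =
      (\<Union>x'\<in>ultra_class U x. ultra_class U (\<lambda>i. c *\<^sub>R x i))"
    by (simp add: ultrapower_def cong: SUP_cong_simp)
  moreover have "ultra_class U x \<noteq> {}"
    using assms ultra_class_self by blast
  ultimately show ?thesis by simp
qed

lemma vnorm_ultra_class: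
  assumes U: "ultrafilter U" and x: "x \<in> ell_infty"
  shows "vnorm (ultrapower U) (ultra_class U x) = Lim U (\<lambda>i. norm (x i))"
    and "((\<lambda>i. norm (x i)) \<longlongrightarrow> vnorm (ultrapower U) (ultra_class U x)) U"
proof -
  have lim: "((\<lambda>i. norm (x i)) \<longlongrightarrow> Lim U (\<lambda>i. norm (x i))) U"
    using x by (intro ultrafilter_tendsto_Lim [OF U])
      (auto simp: ell_infty_def bounded_iff)
  have nb: "U \<noteq> bot" using U by (simp add: ultrafilter_def)
  have "Lim U (\<lambda>i. norm (y i)) = Lim U (\<lambda>i. norm (x i))" if "y \<in> ultra_class U x" for y
  proof (rule tendsto_Lim [OF nb])
    have 0: "((\<lambda>i. norm (x i - y i)) \<longlongrightarrow> 0) U"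
      using that by (auto simp: ultra_class_mem_iff tendsto_norm_zero_iff)
    have "((\<lambda>i. norm (y i) - norm (x i)) \<longlongrightarrow> 0) U"
    proof (rule Lim_null_comparison [OF _ 0], rule always_eventually, rule allI)
      show "norm (norm (y i) - norm (x i)) \<le> norm (x i - y i)" for i
        using norm_triangle_ineq3 [of "y i" "x i"] by (simp add: norm_minus_commute)
    qed
    from tendsto_add [OF this lim] show "((\<lambda>i. norm (y i)) \<longlongrightarrow> Lim U (\<lambda>i. norm (x i))) U"
      by simp
  qed
  then have "(\<lambda>y. Lim U (\<lambda>i. norm (y i))) ` ultra_class U x
      = (\<lambda>_. Lim U (\<lambda>i. norm (x i))) ` ultra_class U x"
    by (rule image_cong [OF refl])
  moreover have "ultra_class U x \<noteq> {}"
    using ultra_class_self [OF x, of U] by blast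
  ultimately have "(\<lambda>y. Lim U (\<lambda>i. norm (y i))) ` ultra_class U x = {Lim U (\<lambda>i. norm (x i))}"
    by (simp only: image_constant_conv if_False)
  then show "vnorm (ultrapower U) (ultra_class U x) = Lim U (\<lambda>i. norm (x i))"
    by (simp add: ultrapower_def)
  with lim show "((\<lambda>i. norm (x i)) \<longlongrightarrow> vnorm (ultrapower U) (ultra_class U x)) U"
    by simp
qed

lemma ultra_pairing_ultra_class:
  fixes f :: "'i \<Rightarrow> 'a::real_normed_vector \<Rightarrow>\<^sub>L real"
  assumes U: "ultrafilter U" and f: "f \<in> ell_infty" and x: "x \<in> ell_infty"
  shows "ultra_pairing U (ultra_class U f) (ultra_class U x) = Lim U (\<lambda>i. f i (x i))"
    and "((\<lambda>i. f i (x i)) \<longlongrightarrow> ultra_pairing U (ultra_class U f) (ultra_class U x)) U"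
proof -
  have bnd: "\<exists>K. \<forall>i. norm (y i) \<le> K" if "y \<in> ell_infty" for y :: "'i \<Rightarrow> 'b::real_normed_vector"
    using that by (auto simp: ell_infty_def bounded_iff)
  obtain K L where K: "\<And>i. norm (f i) \<le> K" and L: "\<And>i. norm (x i) \<le> L"
    using bnd [OF f] bnd [OF x] by blast
  have "\<bar>f i (x i)\<bar> \<le> K * L" for i
  proof -
    have "\<bar>f i (x i)\<bar> \<le> norm (f i) * norm (x i)"
      using norm_blinfun [of "f i" "x i"] by simp
    also have "\<dots> \<le> K * L"
      using K [of i] L [of i] by (intro mult_mono) (auto intro: order_trans [OF norm_ge_zero])
    finally show ?thesis .
  qed
  then have lim: "((\<lambda>i. f i (x i)) \<longlongrightarrow> Lim U (\<lambda>i. f i (x i))) U"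
    by (intro ultrafilter_tendsto_Lim [OF U]) (auto simp: bounded_iff)
  have nb: "U \<noteq> bot" using U by (simp add: ultrafilter_def)
  have "Lim U (\<lambda>i. g i (y i)) = Lim U (\<lambda>i. f i (x i))"
    if g: "g \<in> ultra_class U f" and y: "y \<in> ultra_class U x" for g y
  proof (rule tendsto_Lim [OF nb])
    obtain M where M: "\<And>i. norm (y i) \<le> M"
      using bnd [of y] y by (auto simp: ultra_class_mem_iff)
    have 1: "((\<lambda>i. norm (f i - g i)) \<longlongrightarrow> 0) U" "((\<lambda>i. norm (x i - y i)) \<longlongrightarrow> 0) U"
      using g y by (auto simp: ultra_class_mem_iff tendsto_norm_zero_iff)
    have 0: "((\<lambda>i. K * norm (x i - y i) + norm (f i - g i) * M) \<longlongrightarrow> K * 0 + 0 * M) U"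
      by (intro tendsto_intros 1)
    have "norm (g i (y i) - f i (x i)) \<le> K * norm (x i - y i) + norm (f i - g i) * M" for i
    proof -
      have "g i (y i) - f i (x i) = - (f i (x i - y i)) - (f i - g i) (y i)"
        by (simp add: blinfun.diff_right blinfun.diff_left)
      then have "norm (g i (y i) - f i (x i)) \<le> norm (f i (x i - y i)) + norm ((f i - g i) (y i))"
        using norm_triangle_ineq4 [of "- (f i (x i - y i))" "(f i - g i) (y i)"] by simp
      also have "\<dots> \<le> norm (f i) * norm (x i - y i) + norm (f i - g i) * norm (y i)"
        by (intro add_mono norm_blinfun)
      also have "\<dots> \<le> K * norm (x i - y i) + norm (f i - g i) * M"
        by (intro add_mono mult_right_mono mult_left_mono K M) auto
      finally show ?thesis .
    qed
    then have "((\<lambda>i. g i (y i) - f i (x i)) \<longlongrightarrow> 0) U"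
      by (intro Lim_null_comparison [OF _ 0 [simplified]] always_eventually allI)
    from tendsto_add [OF this lim] show "((\<lambda>i. g i (y i)) \<longlongrightarrow> Lim U (\<lambda>i. f i (x i))) U"
      by simp
  qed
  then have "(\<lambda>(g, y). Lim U (\<lambda>i. blinfun_apply (g i) (y i))) ` (ultra_class U f \<times> ultra_class U x)
      = (\<lambda>_. Lim U (\<lambda>i. f i (x i))) ` (ultra_class U f \<times> ultra_class U x)"
    by (intro image_cong refl) (simp only: mem_Times_iff case_prod_beta)
  moreover have "ultra_class U f \<times> ultra_class U x \<noteq> {}"
    using ultra_class_self [OF x, of U] ultra_class_self [OF f, of U] by blast
  ultimately have "(\<lambda>(g, y). Lim U (\<lambda>i. blinfun_apply (g i) (y i))) `
      (ultra_class U f \<times> ultra_class U x) = {Lim U (\<lambda>i. f i (x i))}"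
    by (simp only: image_constant_conv if_False)
  then show "ultra_pairing U (ultra_class U f) (ultra_class U x) = Lim U (\<lambda>i. f i (x i))"
    by (simp add: ultra_pairing_def)
  with lim show "((\<lambda>i. f i (x i)) \<longlongrightarrow> ultra_pairing U (ultra_class U f) (ultra_class U x)) U"
    by simp
qed

lemma ultra_pairing_in_dual:
  fixes F :: "('i \<Rightarrow> 'a::real_normed_vector \<Rightarrow>\<^sub>L real) set"
  assumes U: "ultrafilter U" and F: "F \<in> carr (ultrapower U)"
  shows "ultra_pairing U F \<in> dual_space (ultrapower U)"
proof -
  have nb: "U \<noteq> bot" using U by (simp add: ultrafilter_def)
  obtain f where f: "f \<in> ell_infty" and Ff: "F = ultra_class U f"
    using F by (auto simp: carr_ultrapower)
  obtain K where K: "\<And>i. norm (f i) \<le> K"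
    using f by (auto simp: ell_infty_def bounded_iff)
  note P = ultra_pairing_ultra_class(2) [OF U f, folded Ff]
  have "ultra_pairing U F (vadd (ultrapower U) (ultra_class U x) (ultra_class U y))
      = ultra_pairing U F (ultra_class U x) + ultra_pairing U F (ultra_class U y)"
    if "x \<in> ell_infty" "y \<in> ell_infty" for x y
    using tendsto_unique [OF nb P [OF ell_infty_add [OF that]]]
      tendsto_add [OF P [OF that(1)] P [OF that(2)]]
    by (simp add: vadd_ultra_class that blinfun.add_right)
  moreover have "ultra_pairing U F (vscale (ultrapower U) c (ultra_class U x))
      = c * ultra_pairing U F (ultra_class U x)" if "x \<in> ell_infty" for c x
    using tendsto_unique [OF nb P [OF ell_infty_scale [OF that, of c]]]
      tendsto_mult_left [OF P [OF that], of c]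
    by (simp add: vscale_ultra_class that blinfun.scaleR_right)
  moreover have "\<bar>ultra_pairing U F (ultra_class U x)\<bar> \<le> K * vnorm (ultrapower U) (ultra_class U x)"
    if "x \<in> ell_infty" for x
  proof (rule tendsto_le [OF nb])
    show "((\<lambda>i. K * norm (x i)) \<longlongrightarrow> K * vnorm (ultrapower U) (ultra_class U x)) U"
      by (intro tendsto_mult_left vnorm_ultra_class(2) U that)
    show "((\<lambda>i. \<bar>f i (x i)\<bar>) \<longlongrightarrow> \<bar>ultra_pairing U F (ultra_class U x)\<bar>) U"
      by (intro tendsto_rabs P that)
    have "\<bar>f i (x i)\<bar> \<le> K * norm (x i)" for i
      using norm_blinfun [of "f i" "x i"] mult_right_mono [OF K [of i] norm_ge_zero [of "x i"]]
      by simp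
    then show "\<forall>\<^sub>F i in U. \<bar>f i (x i)\<bar> \<le> K * norm (x i)" by simp
  qed
  ultimately show ?thesis
    unfolding dual_space_def carr_ultrapower by blast
qed

end

theory Submission
  imports Defs
begin

text \<open>
  The exposing functional in the ultrapower of the dual already strongly exposes the point.  If a
  sequence in \<open>C\<^sub>U\<close> had values tending to the maximum while staying \<open>e\<close>-far from \<open>y\<close>, countable
  saturation would give a single point of \<open>C\<^sub>U\<close> attaining the maximum and \<open>e\<close>-far from \<open>y\<close>.
\<close>

text \<open>A diagonal choice: at each index \<open>i\<close>, pick a point satisfying the strongest
  condition that is available there. Countable incompleteness supplies the sets \<open>J n\<close>,
  which bound the level reachable at each index while leaving every fixed level reachable on a set
  of \<open>U\<close>.\<close>

lemma countable_saturation: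
  fixes U :: "'i filter" and Q :: "nat \<Rightarrow> 'i \<Rightarrow> 'b \<Rightarrow> bool"
  assumes U: "countably_incomplete_ultrafilter U"
    and anti: "\<And>m n i x. m \<le> n \<Longrightarrow> Q n i x \<Longrightarrow> Q m i x"
    and ev: "\<And>m. eventually (\<lambda>i. \<exists>x\<in>C. Q m i x) U"
    and ne: "C \<noteq> {}"
  shows "\<exists>z. (\<forall>i. z i \<in> C) \<and> (\<forall>m. eventually (\<lambda>i. Q m i (z i)) U)"
proof -
  obtain J :: "nat \<Rightarrow> 'i set" where J: "\<And>n. eventually (\<lambda>i. i \<in> J n) U" and J0: "(\<Inter>n. J n) = {}"
    using U by (auto simp: countably_incomplete_ultrafilter_def)
  \<comment> \<open>\<open>N i\<close> collects the levels admissible at \<open>i\<close>. Requiring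
    \<open>i\<close> in all of \<open>J 0\<close>, ..., \<open>J m\<close> makes it finite: once
    \<open>i\<close> misses \<open>J k\<close>, no level from \<open>k\<close> on is
    admissible.\<close>
  define N where "N i = {m. (\<forall>k\<le>m. i \<in> J k) \<and> (\<exists>x\<in>C. Q m i x)}" for i
  have fin: "finite (N i)" for i
  proof -
    obtain k where "i \<notin> J k" using J0 by blast
    then have "N i \<subseteq> {..<k}" unfolding N_def by (auto simp: not_le [symmetric])
    then show ?thesis by (rule finite_subset) simp
  qed
  \<comment> \<open>Choose at the highest admissible level; where no level is admissible, any point
    of \<open>C\<close> serves as a default.\<close>
  have "\<exists>x\<in>C. N i \<noteq> {} \<longrightarrow> Q (Max (N i)) i x" for i
  proof (cases "N i = {}")
    case True
    then show ?thesis using ne by blast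
  next
    case False
    then have "Max (N i) \<in> N i" using fin by simp
    then show ?thesis unfolding N_def by blast
  qed
  then obtain z where zC: "\<And>i. z i \<in> C" and z: "\<And>i. N i \<noteq> {} \<Longrightarrow> Q (Max (N i)) i (z i)"
    by metis
  show ?thesis
  proof (intro exI [of _ z] conjI allI)
    show "z i \<in> C" for i by (rule zC)
    fix m
    \<comment> \<open>For fixed \<open>m\<close>, \<open>U\<close>-almost every \<open>i\<close> has
      \<open>m\<close> in \<open>N i\<close>. The level used there is then at least
      \<open>m\<close>, and \<open>anti\<close> brings its condition down to
      \<open>Q m\<close>.\<close>
    have "eventually (\<lambda>i. \<forall>k\<in>{..m}. i \<in> J k) U"
      using J by (intro eventually_ball_finite) auto
    with ev [of m] show "eventually (\<lambda>i. Q m i (z i)) U"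
    proof eventually_elim
      case (elim i)
      then have "m \<in> N i" by (auto simp: N_def)
      then show ?case using anti [OF Max_ge [OF fin]] z by blast
    qed
  qed
qed

text \<open>Moves distance estimates between the ultrapower and the coordinates of
  representatives.\<close>

lemma vdist_ultra_class:
  assumes U: "ultrafilter U" and "x \<in> ell_infty" "y \<in> ell_infty"
  shows "((\<lambda>i. norm (x i - y i)) \<longlongrightarrow> vdist (ultrapower U) (ultra_class U x) (ultra_class U y)) U"
proof -
  have d: "(\<lambda>i. x i + (-1) *\<^sub>R y i) \<in> ell_infty"
    by (intro ell_infty_add ell_infty_scale assms)
  show ?thesis
    using vnorm_ultra_class(2) [OF U d]
    unfolding vdist_def vscale_ultra_class [OF assms(3)]
      vadd_ultra_class [OF assms(2) ell_infty_scale [OF assms(3)]] by simp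
qed

lemma exposes_imp_strongly_exposes_ultra_set:
  fixes C :: "'a::real_normed_vector set"
  assumes C: "bounded C" and U: "countably_incomplete_ultrafilter U"
    and F: "F \<in> carr (ultrapower U)"
    and ex: "exposes (ultra_pairing U F) y (ultra_set U C)"
  shows "strongly_exposes (ultrapower U) (ultra_pairing U F) y (ultra_set U C)"
proof -
  have uf: "ultrafilter U"
    using U by (simp add: countably_incomplete_ultrafilter_def free_ultrafilter_def)
  then have nb: "U \<noteq> bot" by (simp add: ultrafilter_def)
  have ell: "x \<in> ell_infty" if "\<And>i. x i \<in> C" for x :: "'b \<Rightarrow> 'a"
    unfolding ell_infty_def using bounded_subset [OF C, of "range x"] that by auto
  obtain f where f: "f \<in> ell_infty" and Ff: "F = ultra_class U f"
    using F by (auto simp: carr_ultrapower)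
  obtain b where b: "\<And>i. b i \<in> C" and y: "y = ultra_class U b"
    using ex by (auto simp: exposes_def ultra_set_def)
  note P = ultra_pairing_ultra_class(2) [OF uf f, folded Ff]
  have no_far_maximizers: False
    if e: "e > 0" and far: "\<And>m. \<exists>t\<in>ultra_set U C. e < vdist (ultrapower U) t y \<and>
        \<bar>ultra_pairing U F t - ultra_pairing U F y\<bar> < inverse (real (Suc m))" for e
  proof -
    \<comment> \<open>Only the tolerance on the functional depends on \<open>m\<close>. Both
      inequalities are strict, so they pass from the limit along \<open>U\<close> to almost every
      coordinate.\<close>
    define Q where "Q m i x \<longleftrightarrow> e < norm (x - b i) \<and>
        \<bar>f i x - f i (b i)\<bar> < inverse (real (Suc m))" for m i x
    have ev: "eventually (\<lambda>i. \<exists>x\<in>C. Q m i x) U" for m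
    proof -
      obtain x where x: "\<And>i. x i \<in> C"
        and d: "e < vdist (ultrapower U) (ultra_class U x) y"
        and v: "\<bar>ultra_pairing U F (ultra_class U x) - ultra_pairing U F y\<bar> < inverse (real (Suc m))"
        using far [of m] by (auto simp: ultra_set_def)
      have "eventually (\<lambda>i. e < norm (x i - b i)) U"
        using vdist_ultra_class [OF uf ell ell, of x b] x b d unfolding y
        by (intro order_tendstoD(1)) auto
      moreover have "((\<lambda>i. \<bar>f i (x i) - f i (b i)\<bar>) \<longlongrightarrow>
          \<bar>ultra_pairing U F (ultra_class U x) - ultra_pairing U F y\<bar>) U"
        unfolding y by (intro tendsto_intros P ell x b)
      then have "eventually (\<lambda>i. \<bar>f i (x i) - f i (b i)\<bar> < inverse (real (Suc m))) U"
        using v by (rule order_tendstoD(2))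
      ultimately show ?thesis
        by eventually_elim (use x in \<open>auto simp: Q_def\<close>)
    qed
    have anti: "Q m i x" if "m \<le> n" "Q n i x" for m n i x
    proof -
      have "inverse (real (Suc n)) \<le> inverse (real (Suc m))"
        using that(1) by (intro le_imp_inverse_le) auto
      then show ?thesis using that(2) unfolding Q_def by linarith
    qed
    have ne: "C \<noteq> {}" using b by blast
    have "\<exists>z. (\<forall>i. z i \<in> C) \<and> (\<forall>m. eventually (\<lambda>i. Q m i (z i)) U)"
      by (rule countable_saturation) (fact U anti ev ne)+
    then obtain z where z: "\<And>i. z i \<in> C" and Qz: "\<And>m. eventually (\<lambda>i. Q m i (z i)) U"
      by blast
    \<comment> \<open>The class of \<open>z\<close> meets every tolerance, so it attains the same
      value as \<open>y\<close>. Exposure identifies it with \<open>y\<close>, whereas its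
      coordinates stay \<open>e\<close>-far from those of \<open>b\<close>.\<close>
    have "((\<lambda>i. f i (z i) - f i (b i)) \<longlongrightarrow> 0) U"
    proof (rule tendstoI)
      fix r :: real assume "r > 0"
      then obtain m where "inverse (real (Suc m)) < r" using reals_Archimedean by blast
      then show "eventually (\<lambda>i. dist (f i (z i) - f i (b i)) 0 < r) U"
        using Qz [of m] by (auto simp: Q_def dist_real_def elim: eventually_mono)
    qed
    moreover have "((\<lambda>i. f i (z i) - f i (b i)) \<longlongrightarrow>
        ultra_pairing U F (ultra_class U z) - ultra_pairing U F y) U"
      unfolding y by (intro tendsto_intros P ell z b)
    ultimately have "ultra_pairing U F (ultra_class U z) = ultra_pairing U F y"
      using tendsto_unique [OF nb] by fastforce
    moreover have "ultra_class U z \<in> ultra_set U C"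
      using z by (auto simp: ultra_set_def)
    ultimately have "ultra_class U z = ultra_class U b"
      using ex unfolding exposes_def y by (metis DiffI less_irrefl singletonD)
    then have "((\<lambda>i. norm (z i - b i)) \<longlongrightarrow> 0) U"
      using ultra_class_eq_iff [OF ell ell] z b by blast
    moreover have "eventually (\<lambda>i. e \<le> norm (z i - b i)) U"
      using Qz [of 0] by (auto simp: Q_def elim: eventually_mono)
    ultimately show False
      using tendsto_lowerbound [OF _ _ nb] e by fastforce
  qed
  have "(\<lambda>n. vdist (ultrapower U) (s n) y) \<longlonglongrightarrow> 0"
    if s: "\<And>n. s n \<in> ultra_set U C"
      and lim: "(\<lambda>n. ultra_pairing U F (s n)) \<longlonglongrightarrow> ultra_pairing U F y" for s
  proof (rule ccontr)
    assume "\<not> ?thesis"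
    then obtain r where r: "r > 0"
      and fr: "frequently (\<lambda>n. r \<le> \<bar>vdist (ultrapower U) (s n) y\<bar>) sequentially"
      by (auto simp: tendsto_iff dist_real_def frequently_def not_le)
    \<comment> \<open>Needed to drop the absolute value that negating convergence to 0 leaves in
      \<open>fr\<close>.\<close>
    have nonneg: "0 \<le> vdist (ultrapower U) (s n) y" for n
    proof -
      obtain x where x: "\<And>i. x i \<in> C" "s n = ultra_class U x"
        using s [of n] by (auto simp: ultra_set_def)
      show ?thesis
        using vdist_ultra_class [OF uf ell ell, of x b] x b unfolding y
        by (intro tendsto_lowerbound [OF _ _ nb]) auto
    qed
    \<comment> \<open>Being far happens for infinitely many \<open>n\<close> and being near the
      maximal value for all large \<open>n\<close>, so some \<open>n\<close> does both. Halving
      \<open>r\<close> turns \<open>r \<le>\<close> into the strict bound required.\<close>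
    have "\<exists>t\<in>ultra_set U C. r / 2 < vdist (ultrapower U) t y \<and>
        \<bar>ultra_pairing U F t - ultra_pairing U F y\<bar> < inverse (real (Suc m))" for m
    proof -
      have "eventually (\<lambda>n. \<bar>ultra_pairing U F (s n) - ultra_pairing U F y\<bar> < inverse (real (Suc m)))
          sequentially"
        using tendstoD [OF lim, of "inverse (real (Suc m))"] by (simp add: dist_real_def)
      from frequently_ex [OF frequently_eventually_frequently [OF fr this]]
      obtain n where "r \<le> \<bar>vdist (ultrapower U) (s n) y\<bar>"
        "\<bar>ultra_pairing U F (s n) - ultra_pairing U F y\<bar> < inverse (real (Suc m))" by blast
      moreover from this(1) have "r / 2 < vdist (ultrapower U) (s n) y"
        using r nonneg [of n] by linarith
      ultimately show ?thesis using s by blast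
    qed
    then show False using no_far_maximizers [of "r / 2"] r by simp
  qed
  then show ?thesis using ex by (auto simp: strongly_exposes_def)
qed

theorem theorem3p20:
  fixes C :: "'a::banach set"
    and U :: "'i filter"
    and y :: "('i \<Rightarrow> 'a) set"
    and F :: "('i \<Rightarrow> 'a \<Rightarrow>\<^sub>L real) set"
  assumes "bounded C" and "convex C"
    and "infinite (UNIV :: 'i set)"
    and "countably_incomplete_ultrafilter U"
    and "y \<in> ultra_set U C"
    and "F \<in> carr (ultrapower U)"
    and "exposes (ultra_pairing U F) y (ultra_set U C)"
  shows "strongly_exposed_point (ultrapower U) y (ultra_set U C)"
proof -
  have "ultrafilter U"
    using assms(4) by (simp add: countably_incomplete_ultrafilter_def free_ultrafilter_def)
  then show ?thesis
    unfolding strongly_exposed_point_def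
    using ultra_pairing_in_dual [OF _ assms(6)]
      exposes_imp_strongly_exposes_ultra_set [OF assms(1,4,6,7)] by blast
qed

end
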